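(* Let $k$ be a positive integer. (i) For every $\epsilon>0$ there exists an instance of Graph Balancing with Unrelated Light Hyperedges and Unrelated Heavy Edges with parameter $\beta=0.5$ such that $LP_k$ with target $T=1$ is feasible, and every orientation has makespan at least $\frac{11}{6}-\epsilon$. (ii) For every $\frac1{12}\le\gamma\le\frac14$, target makespan $T$ and $\epsilon>0$, there exists an instance of that problem with $\beta=0.5$ such that $LP_k$ with target $T$ is feasible with optimal value $OPT_{LP_k}$, and every orientation with makespan at most $(1.75+\gamma)T$ has orientation cost at least $\frac{1-\epsilon}{2\gamma+0.5}\,OPT_{LP_k}$.
   Context: Graph Balancing with Unrelated Light Hyperedges and Unrelated Heavy Edges with parameter $\beta$: a hypergraph $(V,E)$ (self-loops, i.e. hyperedges with one vertex, allowed), nonnegative costs $c_{e,u}$ and weights $p_{e,u}$ for $e\in E,u\in e$; each hyperedge is either light ($p_{e,u}\le\beta$ for all $u\in e$) or heavy ($e=\{u,v\}$ with $p_{e,u},p_{e,v}\in(\beta,1]$); the largest weight equals $1$ and the optimal makespan is at least $1$. An orientation assigns each $e$ to $\eta(e)\in e$; load of $u$ is $\sum_{e:\eta(e)=u}p_{e,u}$, makespan is the maximum load, cost is $\sum_e c_{e,\eta(e)}$. Let $\delta(u)$ be the hyperedges containing $u$. The relaxation $LP_k$ for target $T$ has variables $x_{e,u}\ge0$ ($e\in E,u\in e$): minimize $\sum_e\sum_{u\in e}c_{e,u}x_{e,u}$ subject to (Edge) $\sum_{u\in e}x_{e,u}=1$ for all $e$; (Load) $\sum_{e\in\delta(u)}x_{e,u}p_{e,u}\le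 T$ for all $u$; (Star) $\sum_{e\in\delta(u):\,p_{e,u}>T/2}x_{e,u}\le1$ for all $u$; (Set) $\sum_{e\in S}x_{e,u}\le|S|-1$ for all $u$ and all $S\subseteq\delta(u)$ with $\sum_{e\in S}p_{e,u}>T$ and $|S|\le k$; and $x_{e,u}=0$ whenever $p_{e,u}>T$. $OPT_{LP_k}$ denotes its optimal value.
   Formalization: In (ii), as instances are normalised (largest weight 1, optimal makespan at least 1), the claim fails for T<1/2; it is shown as stated for T≥1 (zero costs allowed), and for all T>0 for a normalised instance with all weights multiplied by T, with OPT>0. *)

theory Defs
  imports Complex_Main
begin

text \<open>Hyperedges are vertex sets (a self-loop is a singleton); costs and weights matter only
  at pairs \<open>(e, u)\<close> with \<open>e \<in> hedges I\<close> and \<open>u \<in> e\<close>.\<close>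

record 'v gb =
  verts :: "'v set"
  hedges :: "'v set set"
  cost :: "'v set \<Rightarrow> 'v \<Rightarrow> real"
  weight :: "'v set \<Rightarrow> 'v \<Rightarrow> real"

definition orientation :: "'v gb \<Rightarrow> ('v set \<Rightarrow> 'v) \<Rightarrow> bool" where
  "orientation I \<eta> \<longleftrightarrow> (\<forall>e\<in>hedges I. \<eta> e \<in> e)"

definition load :: "'v gb \<Rightarrow> ('v set \<Rightarrow> 'v) \<Rightarrow> 'v \<Rightarrow> real" where
  "load I \<eta> u = (\<Sum>e\<in>{e \<in> hedges I. \<eta> e = u}. weight I e u)"

definition makespan :: "'v gb \<Rightarrow> ('v set \<Rightarrow> 'v) \<Rightarrow> real" where
  "makespan I \<eta> = Max (load I \<eta> ` verts I)"

definition orientation_cost :: "'v gb \<Rightarrow> ('v set \<Rightarrow> 'v) \<Rightarrow> real" where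
  "orientation_cost I \<eta> = (\<Sum>e\<in>hedges I. cost I e (\<eta> e))"

definition opt_makespan :: "'v gb \<Rightarrow> real" where
  "opt_makespan I = Inf {makespan I \<eta> | \<eta>. orientation I \<eta>}"

definition light :: "real \<Rightarrow> 'v gb \<Rightarrow> 'v set \<Rightarrow> bool" where
  "light \<beta> I e \<longleftrightarrow> (\<forall>u\<in>e. weight I e u \<le> \<beta>)"

definition heavy :: "real \<Rightarrow> 'v gb \<Rightarrow> 'v set \<Rightarrow> bool" where
  "heavy \<beta> I e \<longleftrightarrow> (\<exists>u v. u \<noteq> v \<and> e = {u, v} \<and>
     weight I e u \<in> {\<beta><..1} \<and> weight I e v \<in> {\<beta><..1})"

definition unrelated_gb_instance :: "real \<Rightarrow> 'v gb \<Rightarrow> bool" where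
  "unrelated_gb_instance \<beta> I \<longleftrightarrow>
     finite (verts I) \<and> hedges I \<noteq> {} \<and>
     (\<forall>e\<in>hedges I. e \<noteq> {} \<and> e \<subseteq> verts I) \<and>
     (\<forall>e\<in>hedges I. \<forall>u\<in>e. 0 \<le> cost I e u \<and> 0 \<le> weight I e u) \<and>
     (\<forall>e\<in>hedges I. light \<beta> I e \<or> heavy \<beta> I e) \<and>
     Max {weight I e u | e u. e \<in> hedges I \<and> u \<in> e} = 1 \<and>
     1 \<le> opt_makespan I"

definition incident :: "'v gb \<Rightarrow> 'v \<Rightarrow> 'v set set" where
  "incident I u = {e \<in> hedges I. u \<in> e}"

definition lp_feasible :: "nat \<Rightarrow> real \<Rightarrow> 'v gb \<Rightarrow> ('v set \<Rightarrow> 'v \<Rightarrow> real) \<Rightarrow> bool" where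
  "lp_feasible k T I x \<longleftrightarrow>
     (\<forall>e\<in>hedges I. \<forall>u\<in>e. 0 \<le> x e u) \<and>
     (\<forall>e\<in>hedges I. (\<Sum>u\<in>e. x e u) = 1) \<and>
     (\<forall>u\<in>verts I. (\<Sum>e\<in>incident I u. x e u * weight I e u) \<le> T) \<and>
     (\<forall>u\<in>verts I. (\<Sum>e\<in>{e \<in> incident I u. weight I e u > T / 2}. x e u) \<le> 1) \<and>
     (\<forall>u\<in>verts I. \<forall>S\<subseteq>incident I u.
        (\<Sum>e\<in>S. weight I e u) > T \<and> card S \<le> k \<longrightarrow> (\<Sum>e\<in>S. x e u) \<le> real (card S) - 1) \<and>
     (\<forall>e\<in>hedges I. \<forall>u\<in>e. weight I e u > T \<longrightarrow> x e u = 0)"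

definition lp_cost :: "'v gb \<Rightarrow> ('v set \<Rightarrow> 'v \<Rightarrow> real) \<Rightarrow> real" where
  "lp_cost I x = (\<Sum>e\<in>hedges I. \<Sum>u\<in>e. cost I e u * x e u)"

definition OPT_LP :: "nat \<Rightarrow> real \<Rightarrow> 'v gb \<Rightarrow> real" where
  "OPT_LP k T I = Inf {lp_cost I x | x. lp_feasible k T I x}"

text \<open>The same instance with its weights measured in another unit: the largest weight of
  \<open>scale_weights T I\<close> is \<open>T\<close> times that of \<open>I\<close>.\<close>

definition scale_weights :: "real \<Rightarrow> 'v gb \<Rightarrow> 'v gb" where
  "scale_weights T I = I\<lparr>weight := \<lambda>e u. T * weight I e u\<rparr>"

text \<open>\<open>J\<close> witnesses that rounding \<open>LP\<^sub>k\<close> with target \<open>T\<close> to makespan at most \<open>\<alpha> * T\<close> loses a factor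
  of at least \<open>\<rho>\<close> in the cost.\<close>

definition cost_gap :: "nat \<Rightarrow> real \<Rightarrow> real \<Rightarrow> real \<Rightarrow> 'v gb \<Rightarrow> bool" where
  "cost_gap k T \<alpha> \<rho> J \<longleftrightarrow>
     (\<exists>x. lp_feasible k T J x) \<and>
     (\<forall>\<eta>. orientation J \<eta> \<and> makespan J \<eta> \<le> \<alpha> * T \<longrightarrow>
        orientation_cost J \<eta> \<ge> \<rho> * OPT_LP k T J)"

end

theory Submission
  imports Defs "HOL-Library.Countable"
begin

text \<open>
  A long path of heavy edges, each with one end of weight almost \<open>1\<close> and one of weight almost
  \<open>1 / 2\<close>, behaves like a single binary switch: every interior vertex can afford only one heavy edge,
  so as soon as one edge points left, all edges before it do. Let every edge point left to the
  extent \<open>b\<close>. The interior vertices then have room \<open>b / 2\<close> for fixed load, and one light hyperedge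
  of weight \<open>1 / 2\<close>, spread thinly over them, must finally sit at some vertex, whose load exceeds
  \<open>3 / 2 + b / 2\<close> up to a small error unless its left edge points left. Hence below this bound the
  first edge is forced to the first vertex of the path although \<open>LP\<^sub>k\<close> puts only \<open>b\<close> of it there:
  charging for it loses the factor \<open>1 / b\<close>, and \<open>b > 1 / 2 + 2 \<gamma>\<close> suffices for \<open>7 / 4 + \<gamma>\<close>.
  For part (i) take \<open>b = 2 / 3\<close>: the first vertices have room \<open>1 / 3\<close> for fixed load, and a further
  light hyperedge spread over the first vertices of many paths produces load
  \<open>1 + 1 / 2 + 1 / 3 = 11 / 6\<close>.

  The fixed load consists of more than \<open>k\<close> tiny pieces, so that no set constraint sees it. As
  hyperedges are sets, parallel self-loops are not available; each piece instead joins its vertex to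
  a vertex \<open>D m\<close> shared by all copies, where its weight is \<open>1 / 2\<close>. The few shared vertices absorb
  a negligible part of the pieces.
\<close>

section \<open>Monotonicity and scaling\<close>

lemma finite_hedges:
  assumes "unrelated_gb_instance \<beta> I"
  shows "finite (hedges I)"
proof (rule finite_subset)
  show "hedges I \<subseteq> Pow (verts I)" "finite (Pow (verts I))"
    using assms by (auto simp: unrelated_gb_instance_def)
qed

text \<open>A larger target weakens each constraint. Only the star constraint takes an argument:
  fewer hyperedges exceed the new threshold, and the dropped terms are nonnegative.\<close>

lemma lp_feasible_mono:
  assumes "finite (hedges I)" "lp_feasible k T I x" "T \<le> T'"
  shows "lp_feasible k T' I x"
proof -
  have fin: "finite (incident I u)" for u
    using assms(1) by (simp add: incident_def)
  have "(\<Sum>e\<in>{e \<in> incident I u. weight I e u > T' / 2}. x e u)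
      \<le> (\<Sum>e\<in>{e \<in> incident I u. weight I e u > T / 2}. x e u)" if "u \<in> verts I" for u
  proof (rule sum_mono2)
    show "finite {e \<in> incident I u. weight I e u > T / 2}" using fin by simp
    show "{e \<in> incident I u. weight I e u > T' / 2} \<subseteq> {e \<in> incident I u. weight I e u > T / 2}"
      using assms(3) by auto
    show "\<And>e. e \<in> {e \<in> incident I u. weight I e u > T / 2}
        - {e \<in> incident I u. weight I e u > T' / 2} \<Longrightarrow> 0 \<le> x e u"
      using assms(2) by (auto simp: lp_feasible_def incident_def)
  qed
  then show ?thesis
    using assms(2,3) unfolding lp_feasible_def by (smt (verit, ccfv_threshold))
qed

lemma lp_feasible_scale_weights:
  assumes "lp_feasible k 1 I x" "T > 0"
  shows "lp_feasible k T (scale_weights T I) x"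
proof -
  have inc: "incident (scale_weights T I) u = incident I u" for u
    by (simp add: incident_def scale_weights_def)
  have load: "(\<Sum>e\<in>S. x e u * (T * weight I e u)) = T * (\<Sum>e\<in>S. x e u * weight I e u)" for S u
    by (simp add: sum_distrib_left mult.left_commute)
  have le: "T * a \<le> T \<longleftrightarrow> a \<le> 1" and less: "T < T * a \<longleftrightarrow> 1 < a"
    and half: "T < T * a * 2 \<longleftrightarrow> 1 < a * 2" for a :: real
    using \<open>T > 0\<close> by (auto simp: field_simps)
  show ?thesis
    using assms(1) unfolding lp_feasible_def inc
    by (simp add: scale_weights_def load le less half sum_distrib_left[symmetric])
qed

lemma makespan_scale_weights:
  assumes "finite (verts I)" "verts I \<noteq> {}" "T > 0"
  shows "makespan (scale_weights T I) \<eta> = T * makespan I \<eta>"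
proof -
  have "load (scale_weights T I) \<eta> = (\<lambda>u. T * load I \<eta> u)"
    by (auto simp: load_def scale_weights_def sum_distrib_left)
  then have "makespan (scale_weights T I) \<eta> = Max ((\<lambda>y. T * y) ` load I \<eta> ` verts I)"
    by (simp add: makespan_def image_image) (simp add: scale_weights_def)
  also have "\<dots> = T * makespan I \<eta>"
    unfolding makespan_def using assms
    by (intro mono_Max_commute[symmetric]) (auto simp: mono_def)
  finally show ?thesis .
qed

section \<open>Instances with labelled hyperedges\<close>

text \<open>Instances are built from labels rather than sets of naturals, so that sums over
  hyperedges become sums over labels. \<open>inj_ends\<close> excludes parallel hyperedges: no two
  labels merge into one set.\<close>

locale labelled_hypergraph =
  fixes code :: "'v \<Rightarrow> nat" and Vs :: "'v set" and Es :: "'e set" and ends :: "'e \<Rightarrow> 'v set"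
    and w c :: "'e \<Rightarrow> 'v \<Rightarrow> real"
  assumes inj_code: "inj code"
    and finite_Vs: "finite Vs"
    and finite_Es: "finite Es"
    and inj_ends: "inj_on ends Es"
    and ends_subset: "e \<in> Es \<Longrightarrow> ends e \<subseteq> Vs"
    and ends_nonempty: "e \<in> Es \<Longrightarrow> ends e \<noteq> {}"
begin

definition hyperedge :: "'e \<Rightarrow> nat set" where
  "hyperedge e = code ` ends e"

definition lift :: "('e \<Rightarrow> 'v \<Rightarrow> real) \<Rightarrow> nat set \<Rightarrow> nat \<Rightarrow> real" where
  "lift f h u = f (inv_into Es hyperedge h) (inv code u)"

definition inst :: "nat gb" where
  "inst = \<lparr>verts = code ` Vs, hedges = hyperedge ` Es, cost = lift c, weight = lift w\<rparr>"

definition label_orientation :: "(nat set \<Rightarrow> nat) \<Rightarrow> 'e \<Rightarrow> 'v" where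
  "label_orientation \<eta> e = inv code (\<eta> (hyperedge e))"

lemma inst_simps [simp]:
  "verts inst = code ` Vs" "hedges inst = hyperedge ` Es" "cost inst = lift c" "weight inst = lift w"
  by (simp_all add: inst_def)

lemma inj_hyperedge: "inj_on hyperedge Es"
  using inj_ends inj_code by (auto simp: inj_on_def hyperedge_def inj_image_eq_iff)

lemma lift_hyperedge [simp]: "e \<in> Es \<Longrightarrow> lift f (hyperedge e) (code v) = f e v"
  using inj_hyperedge inj_code by (simp add: lift_def)

lemma code_mem_hyperedge [simp]: "code v \<in> hyperedge e \<longleftrightarrow> v \<in> ends e"
  using inj_code by (auto simp: hyperedge_def inj_def)

lemma sum_hyperedge: "(\<Sum>u\<in>hyperedge e. g u) = (\<Sum>v\<in>ends e. g (code v))"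
  unfolding hyperedge_def using inj_code by (subst sum.reindex) (auto simp: inj_def inj_on_def)

lemma sum_image_hyperedge:
  "S \<subseteq> Es \<Longrightarrow> (\<Sum>h\<in>hyperedge ` S. g h) = (\<Sum>e\<in>S. g (hyperedge e))"
  using inj_hyperedge by (subst sum.reindex) (auto intro: inj_on_subset)

lemma incident_inst: "incident inst (code v) = hyperedge ` {e \<in> Es. v \<in> ends e}"
  by (auto simp: incident_def)

lemma code_label_orientation:
  assumes "orientation inst \<eta>" "e \<in> Es"
  shows "code (label_orientation \<eta> e) = \<eta> (hyperedge e)" "label_orientation \<eta> e \<in> ends e"
proof -
  have "\<eta> (hyperedge e) \<in> code ` ends e"
    using assms by (auto simp: orientation_def hyperedge_def[symmetric])
  then show "code (label_orientation \<eta> e) = \<eta> (hyperedge e)" "label_orientation \<eta> e \<in> ends e"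
    using inj_code by (auto simp: label_orientation_def)
qed

lemma load_inst:
  assumes "orientation inst \<eta>"
  shows "load inst \<eta> (code v) = (\<Sum>e\<in>{e \<in> Es. label_orientation \<eta> e = v}. w e v)"
proof -
  have "{h \<in> hedges inst. \<eta> h = code v} = hyperedge ` {e \<in> Es. label_orientation \<eta> e = v}"
    using code_label_orientation(1)[OF assms] inj_code by (auto simp: inj_def)
  then show ?thesis
    unfolding load_def by (simp add: sum_image_hyperedge)
qed

lemma load_le_makespan:
  assumes "orientation inst \<eta>" "v \<in> Vs"
  shows "(\<Sum>e\<in>{e \<in> Es. label_orientation \<eta> e = v}. w e v) \<le> makespan inst \<eta>"
  unfolding makespan_def load_inst[OF assms(1), symmetric]
  using assms(2) finite_Vs by (intro Max_ge) auto

lemma orientation_cost_inst: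
  assumes "orientation inst \<eta>"
  shows "orientation_cost inst \<eta> = (\<Sum>e\<in>Es. c e (label_orientation \<eta> e))"
  unfolding orientation_cost_def
  by (simp add: sum_image_hyperedge code_label_orientation(1)[OF assms, symmetric])

lemma lp_cost_inst: "lp_cost inst (lift x) = (\<Sum>e\<in>Es. \<Sum>v\<in>ends e. c e v * x e v)"
  unfolding lp_cost_def by (simp add: sum_image_hyperedge sum_hyperedge)

lemma lp_feasible_inst:
  assumes nonneg: "\<And>e v. e \<in> Es \<Longrightarrow> v \<in> ends e \<Longrightarrow> 0 \<le> x e v"
    and edge: "\<And>e. e \<in> Es \<Longrightarrow> (\<Sum>v\<in>ends e. x e v) = 1"
    and load: "\<And>v. v \<in> Vs \<Longrightarrow> (\<Sum>e\<in>{e \<in> Es. v \<in> ends e}. x e v * w e v) \<le> T"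
    and star: "\<And>v. v \<in> Vs \<Longrightarrow> (\<Sum>e\<in>{e \<in> Es. v \<in> ends e \<and> w e v > T / 2}. x e v) \<le> 1"
    and set: "\<And>v S. v \<in> Vs \<Longrightarrow> S \<subseteq> {e \<in> Es. v \<in> ends e} \<Longrightarrow> (\<Sum>e\<in>S. w e v) > T \<Longrightarrow> card S \<le> k
      \<Longrightarrow> (\<Sum>e\<in>S. x e v) \<le> real (card S) - 1"
    and big: "\<And>e v. e \<in> Es \<Longrightarrow> v \<in> ends e \<Longrightarrow> w e v \<le> T"
  shows "lp_feasible k T inst (lift x)"
  unfolding lp_feasible_def
proof (intro conjI ballI allI impI)
  fix h u assume "h \<in> hedges inst" "u \<in> h"
  then obtain e v where *: "e \<in> Es" "v \<in> ends e" "h = hyperedge e" "u = code v"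
    by (auto simp: hyperedge_def)
  show "0 \<le> lift x h u" using * nonneg by simp
  assume "weight inst h u > T" then show "lift x h u = 0" using * big[of e v] by simp
next
  fix h assume "h \<in> hedges inst"
  then show "(\<Sum>u\<in>h. lift x h u) = 1" using edge by (auto simp: sum_hyperedge)
next
  fix u assume "u \<in> verts inst"
  then obtain v where v: "v \<in> Vs" "u = code v" by auto
  show "(\<Sum>h\<in>incident inst u. lift x h u * weight inst h u) \<le> T"
    using load[OF v(1)] by (simp add: v(2) incident_inst sum_image_hyperedge)
  have "{h \<in> incident inst u. weight inst h u > T / 2}
      = hyperedge ` {e \<in> Es. v \<in> ends e \<and> w e v > T / 2}"
    by (auto simp: v(2) incident_inst)
  then show "(\<Sum>h\<in>{h \<in> incident inst u. weight inst h u > T / 2}. lift x h u) \<le> 1"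
    using star[OF v(1)] by (simp add: v(2) sum_image_hyperedge)
  fix S assume S: "S \<subseteq> incident inst u" and *: "T < (\<Sum>h\<in>S. weight inst h u) \<and> card S \<le> k"
  obtain S' where S': "S' \<subseteq> {e \<in> Es. v \<in> ends e}" "S = hyperedge ` S'"
    using S unfolding v(2) incident_inst by (auto simp: subset_image_iff)
  have sub: "S' \<subseteq> Es" using S' by auto
  have "card S = card S'"
    using S'(2) sub inj_hyperedge by (metis card_image inj_on_subset)
  moreover have "(\<Sum>h\<in>S. lift f h u) = (\<Sum>e\<in>S'. f e v)" for f
    unfolding S'(2) v(2) sum_image_hyperedge[OF sub] using sub by (intro sum.cong) auto
  ultimately show "(\<Sum>h\<in>S. lift x h u) \<le> real (card S) - 1"
    using set[OF v(1) S'(1)] * by simp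
qed

text \<open>A hyperedge \<open>eu\<close> of weight 1 at each of its ends settles both
  normalisations: it attains the largest weight, and whichever end receives it has load at least
  1.\<close>

lemma unrelated_gb_instance_inst:
  assumes nonneg: "\<And>e v. e \<in> Es \<Longrightarrow> v \<in> ends e \<Longrightarrow> 0 \<le> c e v \<and> 0 \<le> w e v \<and> w e v \<le> 1"
    and kind: "\<And>e. e \<in> Es \<Longrightarrow> (\<forall>v\<in>ends e. w e v \<le> \<beta>) \<or>
      (\<exists>u v. u \<noteq> v \<and> ends e = {u, v} \<and> w e u \<in> {\<beta><..1} \<and> w e v \<in> {\<beta><..1})"
    and unit: "eu \<in> Es" "\<And>v. v \<in> ends eu \<Longrightarrow> w eu v = 1"
  shows "unrelated_gb_instance \<beta> inst"
  unfolding unrelated_gb_instance_def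
proof (intro conjI ballI)
  show "finite (verts inst)" "hedges inst \<noteq> {}" using finite_Vs unit by auto
  fix h assume "h \<in> hedges inst"
  then obtain e where e: "e \<in> Es" "h = hyperedge e" by auto
  show "h \<noteq> {}" "h \<subseteq> verts inst"
    using ends_nonempty[OF e(1)] ends_subset[OF e(1)] by (auto simp: e(2) hyperedge_def)
  show "light \<beta> inst h \<or> heavy \<beta> inst h"
    using kind[OF e(1)]
  proof
    assume "\<forall>v\<in>ends e. w e v \<le> \<beta>"
    then have "light \<beta> inst h"
      using e by (auto simp: light_def hyperedge_def[of e]) (auto simp: hyperedge_def[symmetric])
    then show ?thesis ..
  next
    assume "\<exists>u v. u \<noteq> v \<and> ends e = {u, v} \<and> w e u \<in> {\<beta><..1} \<and> w e v \<in> {\<beta><..1}"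
    then obtain u v where *: "u \<noteq> v" "ends e = {u, v}" "w e u \<in> {\<beta><..1}" "w e v \<in> {\<beta><..1}"
      by blast
    have "code u \<noteq> code v" "h = {code u, code v}"
      using * e inj_code by (auto simp: hyperedge_def inj_def)
    moreover have "weight inst h (code u) = w e u" "weight inst h (code v) = w e v"
      using e by auto
    ultimately have "heavy \<beta> inst h"
      unfolding heavy_def using *(3,4) by (metis (no_types, lifting))
    then show ?thesis ..
  qed
  fix u assume "u \<in> h"
  then obtain v where "v \<in> ends e" "u = code v" using e by (auto simp: hyperedge_def)
  then show "0 \<le> cost inst h u" "0 \<le> weight inst h u" using nonneg[OF e(1)] e by auto
next
  obtain v0 where v0: "v0 \<in> ends eu" using ends_nonempty[OF unit(1)] by auto
  let ?W = "{weight inst e u |e u. e \<in> hedges inst \<and> u \<in> e}"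
  have W: "?W = {w e v |e v. e \<in> Es \<and> v \<in> ends e}"
  proof (intro equalityI subsetI)
    fix a assume "a \<in> ?W"
    then obtain e u where "e \<in> Es" "u \<in> hyperedge e" "a = lift w (hyperedge e) u" by auto
    moreover from this obtain v where "v \<in> ends e" "u = code v" by (auto simp: hyperedge_def)
    ultimately show "a \<in> {w e v |e v. e \<in> Es \<and> v \<in> ends e}" by auto
  next
    fix a assume "a \<in> {w e v |e v. e \<in> Es \<and> v \<in> ends e}"
    then obtain e v where *: "e \<in> Es" "v \<in> ends e" "a = w e v" by auto
    show "a \<in> ?W"
      using * by (auto intro!: exI[of _ "hyperedge e"] exI[of _ "code v"])
  qed
  have "?W \<subseteq> (\<lambda>(e, v). w e v) ` (Es \<times> Vs)"
    unfolding W using ends_subset by force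
  then have "finite ?W" using finite_Es finite_Vs by (meson finite_SigmaI finite_imageI finite_subset)
  moreover have "1 \<in> ?W" unfolding W using unit v0 by (auto intro!: exI[of _ eu] exI[of _ v0])
  moreover have "a \<le> 1" if "a \<in> ?W" for a using that nonneg unfolding W by auto
  ultimately show "Max ?W = 1" by (intro Max_eqI)
  have "1 \<le> makespan inst \<eta>" if "orientation inst \<eta>" for \<eta>
  proof -
    let ?v = "label_orientation \<eta> eu"
    have v: "?v \<in> ends eu" using code_label_orientation[OF that unit(1)] by auto
    have "1 = (\<Sum>e\<in>{eu}. w e ?v)" using unit(2) v by simp
    also have "\<dots> \<le> (\<Sum>e\<in>{e \<in> Es. label_orientation \<eta> e = ?v}. w e ?v)"
      using unit(1) finite_Es nonneg code_label_orientation(2)[OF that]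
      by (intro sum_mono2) (auto, metis)
    also have "\<dots> \<le> makespan inst \<eta>"
      using load_le_makespan[OF that] v ends_subset[OF unit(1)] by auto
    finally show ?thesis .
  qed
  moreover have "\<exists>\<eta>. orientation inst \<eta>"
  proof
    show "orientation inst (\<lambda>h. SOME u. u \<in> h)"
      using ends_nonempty by (auto simp: orientation_def hyperedge_def some_in_eq)
  qed
  ultimately show "1 \<le> opt_makespan inst"
    unfolding opt_makespan_def by (intro cInf_greatest) auto
qed

end

text \<open>Two elements together contribute at most 1 and every other one at most 1, which saves a
  full unit. Set constraints are verified this way.\<close>

lemma sum_le_card_minus_1:
  fixes x :: "'a \<Rightarrow> real"
  assumes "finite A" "card A \<ge> 2" "\<And>e. e \<in> A \<Longrightarrow> x e \<le> 1"
    and "\<And>e e'. e \<in> A \<Longrightarrow> e' \<in> A \<Longrightarrow> e \<noteq> e' \<Longrightarrow> x e + x e' \<le> 1"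
  shows "sum x A \<le> real (card A) - 1"
proof -
  obtain a where a: "a \<in> A" using assms(2) by fastforce
  then obtain a' where a': "a' \<in> A" "a' \<noteq> a"
    using assms(1,2) by (metis card_le_Suc0_iff_eq not_less_eq_eq numeral_2_eq_2)
  have "sum x A = x a + x a' + sum x (A - {a, a'})"
    using a a' assms(1) by (subst sum.subset_diff[of "{a, a'}"]) auto
  also have "\<dots> \<le> 1 + sum (\<lambda>_. 1) (A - {a, a'})"
    using a a' assms by (intro add_mono sum_mono) auto
  also have "\<dots> = real (card A) - 1"
    using a a' assms(1,2) by (simp add: card_Diff_subset of_nat_diff)
  finally show ?thesis .
qed

section \<open>The gap instance\<close>

datatype vertex = V nat nat nat | D nat | Z bool

instance vertex :: countable
  by countable_datatype

text \<open>\<open>V c q j\<close> is vertex \<open>j\<close> of path \<open>q\<close> in copy \<open>c\<close>. The labels \<open>H\<close> are the heavy path edges, \<open>F\<close> the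
  light hyperedge of a path, \<open>G\<close> that of a copy, and \<open>U\<close> the pieces of fixed load (dust). The separate
  edge \<open>Zed\<close> of weight and cost \<open>1\<close> makes the largest weight \<open>1\<close>, the optimal makespan at least \<open>1\<close> and
  the optimal value of the relaxation positive.\<close>

datatype label = H nat nat nat | F nat nat | G nat | U nat nat nat nat | Zed

text \<open>\<open>n\<close> is at once the number of edges of a path, the number of paths of a copy
  and the inverse of the error \<delta>; \<open>P\<close> counts the copies. The two bounds keep
  \<open>dust\<close> nonnegative and leave space for a share \<delta> beside \<open>b\<close> or
  \<open>1 - b\<close>.\<close>

locale gap_instance =
  fixes k n P :: nat and b :: real
  assumes k_pos: "k > 0" and n_pos: "n > 0" and b_lower: "4 / n \<le> b" and b_upper: "4 / n \<le> 1 - b"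
begin

definition \<delta> :: real where
  "\<delta> = 1 / n"

fun ends :: "label \<Rightarrow> vertex set" where
  "ends (H c q i) = {V c q i, V c q (Suc i)}"
| "ends (F c q) = V c q ` {1..n}"
| "ends (G c) = (\<lambda>q. V c q 0) ` {..<n}"
| "ends (U c q j m) = {V c q j, D m}"
| "ends Zed = {Z False, Z True}"

text \<open>The room left by the fractional solution: the first vertex carries about
  \<open>b\<close> of the first edge, an interior one about \<open>(1 - b) + b / 2\<close>. The
  deduction \<open>2 * \<delta>\<close> absorbs the corrections in the weights and the share of a
  light hyperedge.\<close>

definition dust :: "nat \<Rightarrow> real" where
  "dust j = (if j = 0 then 1 - b else b / 2) - 2 * \<delta>"

text \<open>The first edge is large at both ends; later ones are barely heavy at their left end.
  Staying \<delta> below 1 lets up to \<open>k\<close> pieces of dust join one heavy edge without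
  exceeding the target, so that no set constraint applies to them.\<close>

fun wt :: "label \<Rightarrow> vertex \<Rightarrow> real" where
  "wt (H c q i) v = (if v = V c q i \<and> 0 < i then 1 / 2 + \<delta> else 1 - \<delta>)"
| "wt (F c q) v = 1 / 2"
| "wt (G c) v = 1 / 2"
| "wt (U c q j m) v = (if v = D m then 1 / 2 else dust j / (k * n))"
| "wt Zed v = 1"

fun cst :: "label \<Rightarrow> vertex \<Rightarrow> real" where
  "cst (H c q i) v = (if v = V c q 0 then 1 else 0)"
| "cst (F c q) v = 0"
| "cst (G c) v = 0"
| "cst (U c q j m) v = 0"
| "cst Zed v = 1"

fun frac :: "label \<Rightarrow> vertex \<Rightarrow> real" where
  "frac (H c q i) v = (if v = V c q i then b else 1 - b)"
| "frac (F c q) v = \<delta>"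
| "frac (G c) v = \<delta>"
| "frac (U c q j m) v = (if v = D m then 0 else 1)"
| "frac Zed v = 1 / 2"

definition Es :: "label set" where
  "Es = {e. case e of H c q i \<Rightarrow> c < P \<and> q < n \<and> i < n | F c q \<Rightarrow> c < P \<and> q < n | G c \<Rightarrow> c < P
    | U c q j m \<Rightarrow> c < P \<and> q < n \<and> j \<le> n \<and> m < k * n | Zed \<Rightarrow> True}"

definition Vs :: "vertex set" where
  "Vs = (\<Union>c<P. \<Union>q<n. V c q ` {..n}) \<union> D ` {..<k * n} \<union> range Z"

lemma mem_Es [simp]:
  "H c q i \<in> Es \<longleftrightarrow> c < P \<and> q < n \<and> i < n"
  "F c q \<in> Es \<longleftrightarrow> c < P \<and> q < n"
  "G c \<in> Es \<longleftrightarrow> c < P"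
  "U c q j m \<in> Es \<longleftrightarrow> c < P \<and> q < n \<and> j \<le> n \<and> m < k * n"
  "Zed \<in> Es"
  by (simp_all add: Es_def)

lemma mem_Vs [simp]:
  "V c q j \<in> Vs \<longleftrightarrow> c < P \<and> q < n \<and> j \<le> n"
  "D m \<in> Vs \<longleftrightarrow> m < k * n"
  "Z s \<in> Vs"
  by (auto simp: Vs_def)

lemma finite_Es: "finite Es"
proof (rule finite_subset)
  show "Es \<subseteq> (\<lambda>(c, q, i). H c q i) ` ({..<P} \<times> {..<n} \<times> {..<n}) \<union> (\<lambda>(c, q). F c q) ` ({..<P} \<times> {..<n})
    \<union> G ` {..<P} \<union> (\<lambda>(c, q, j, m). U c q j m) ` ({..<P} \<times> {..<n} \<times> {..n} \<times> {..<k * n}) \<union> {Zed}"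
    (is "_ \<subseteq> ?R")
  proof
    fix e assume "e \<in> Es"
    then show "e \<in> ?R" by (cases e) (simp_all add: image_iff)
  qed
qed simp

lemma finite_Vs: "finite Vs"
  by (simp add: Vs_def)

lemma \<delta>_bounds: "0 < \<delta>" "\<delta> \<le> 1 / 8" "4 * \<delta> \<le> b" "4 * \<delta> \<le> 1 - b" "0 < b" "b < 1"
proof -
  show *: "0 < \<delta>" "4 * \<delta> \<le> b" "4 * \<delta> \<le> 1 - b"
    using n_pos b_lower b_upper by (auto simp: \<delta>_def)
  show "\<delta> \<le> 1 / 8" "0 < b" "b < 1" using * by linarith+
qed

lemma n_ge: "n \<ge> 8"
  using \<delta>_bounds(2) n_pos by (simp add: \<delta>_def field_simps)

lemma n_\<delta> [simp]: "real n * \<delta> = 1"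
  using n_pos by (simp add: \<delta>_def)

lemma dust_bounds: "0 \<le> dust j" "dust j \<le> 1"
  using \<delta>_bounds unfolding dust_def by auto

lemma dust_weight: "0 \<le> dust j / (k * n)" "dust j / (k * n) \<le> \<delta> / k" "dust j / (k * n) \<le> \<delta>"
proof -
  show "0 \<le> dust j / (k * n)" using dust_bounds by simp
  have "dust j / (k * n) \<le> 1 / (k * n)"
    using dust_bounds by (intro divide_right_mono) auto
  then show le: "dust j / (k * n) \<le> \<delta> / k" by (simp add: \<delta>_def mult.commute)
  also have "\<dots> \<le> \<delta> / 1" using k_pos \<delta>_bounds(1) by (intro divide_left_mono) auto
  finally show "dust j / (k * n) \<le> \<delta>" by simp
qed

lemma wt_bounds: "0 \<le> wt e v" "wt e v \<le> 1"
proof -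
  have "0 \<le> wt e v \<and> wt e v \<le> 1"
  proof (cases e)
    case (U c q j m)
    then show ?thesis using dust_weight(1,3)[of j] \<delta>_bounds(2) by (auto simp del: of_nat_mult)
  qed (use \<delta>_bounds(1,2) in auto)
  then show "0 \<le> wt e v" "wt e v \<le> 1" by auto
qed

lemma cst_nonneg: "0 \<le> cst e v"
  by (cases e) auto

text \<open>Three ends separate \<open>F\<close> from the two-element path edges, and two ends on
  different paths identify \<open>G\<close>; the bound \<open>n \<ge> 8\<close> guarantees that they
  exist.\<close>

lemma inj_ends: "inj_on ends Es"
proof (rule inj_onI)
  fix e e' assume eq: "ends e = ends e'"
  have inF: "V c q 1 \<in> ends (F c q)" "V c q 2 \<in> ends (F c q)" "V c q 3 \<in> ends (F c q)" for c q
    using n_ge by auto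
  have inG: "V c 0 0 \<in> ends (G c)" "V c 1 0 \<in> ends (G c)" for c
    using n_ge by auto
  show "e = e'"
  proof (cases e)
    case (H c q i)
    have mem: "V c q i \<in> ends e'" "V c q (Suc i) \<in> ends e'" using eq H by auto
    show ?thesis
    proof (cases e')
      case (F c' q')
      then have "V c' q' 1 \<in> ends e" "V c' q' 2 \<in> ends e" "V c' q' 3 \<in> ends e"
        using inF[of c' q'] eq by metis+
      then show ?thesis using H by auto
    qed (use mem H in auto)
  next
    case (F c q)
    then have "V c q 1 \<in> ends e'" "V c q 2 \<in> ends e'" "V c q 3 \<in> ends e'"
      using inF[of c q] eq by metis+
    then show ?thesis using F by (cases e') auto
  next
    case (G c)
    then have "V c 0 0 \<in> ends e'" "V c 1 0 \<in> ends e'" using inG[of c] eq by metis+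
    then show ?thesis using G by (cases e') auto
  next
    case (U c q j m)
    then have "V c q j \<in> ends e'" "D m \<in> ends e'" using eq by auto
    then show ?thesis using U by (cases e') auto
  next
    case Zed
    then have "Z False \<in> ends e'" using eq by auto
    then show ?thesis using Zed by (cases e') auto
  qed
qed

sublocale labelled_hypergraph to_nat Vs Es ends wt cst
proof
  show "ends e \<subseteq> Vs" if "e \<in> Es" for e
    using that by (cases e) auto
  show "ends e \<noteq> {}" for e
    using n_pos by (cases e) auto
qed (use finite_Es finite_Vs inj_ends in auto)

lemma unrelated: "unrelated_gb_instance (1 / 2) inst"
proof (rule unrelated_gb_instance_inst[where eu = Zed])
  fix e v assume "e \<in> Es" "v \<in> ends e"
  show "0 \<le> cst e v \<and> 0 \<le> wt e v \<and> wt e v \<le> 1"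
    using wt_bounds cst_nonneg by blast
next
  fix e assume "e \<in> Es"
  show "(\<forall>v\<in>ends e. wt e v \<le> 1 / 2) \<or>
      (\<exists>u v. u \<noteq> v \<and> ends e = {u, v} \<and> wt e u \<in> {1 / 2<..1} \<and> wt e v \<in> {1 / 2<..1})"
  proof (cases e)
    case (H c q i)
    have "wt e (V c q i) \<in> {1 / 2<..1}" "wt e (V c q (Suc i)) \<in> {1 / 2<..1}"
      using H \<delta>_bounds(1,2) by auto
    then show ?thesis
      using H by (intro disjI2 exI[of _ "V c q i"] exI[of _ "V c q (Suc i)"]) auto
  next
    case (U c q j m)
    then show ?thesis using dust_weight(3)[of j] \<delta>_bounds(2) by (auto simp del: of_nat_mult)
  next
    case Zed
    then show ?thesis by (intro disjI2 exI[of _ "Z False"] exI[of _ "Z True"]) auto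
  qed auto
qed auto

section \<open>Feasibility of the fractional solution\<close>

lemma incident_V:
  assumes "c < P" "q < n" "j \<le> n"
  shows "{e \<in> Es. V c q j \<in> ends e} =
    (if j = 0 then {G c} else {H c q (j - 1), F c q}) \<union> (if j < n then {H c q j} else {})
    \<union> U c q j ` {..<k * n}" (is "?L = ?R")
proof (rule set_eqI)
  fix e show "e \<in> ?L \<longleftrightarrow> e \<in> ?R"
    using assms by (cases e) auto
qed

lemma sum_incident_V:
  assumes "c < P" "q < n" "j \<le> n"
  shows "(\<Sum>e\<in>{e \<in> Es. V c q j \<in> ends e}. f e) =
    (if j = 0 then f (G c) else f (H c q (j - 1)) + f (F c q)) + (if j < n then f (H c q j) else 0)
    + (\<Sum>m<k * n. f (U c q j m))" (is "_ = ?R")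
proof -
  let ?X = "if j = 0 then {G c} else {H c q (j - 1), F c q}"
  let ?Y = "if j < n then {H c q j} else {}"
  have "(\<Sum>e\<in>?X \<union> ?Y \<union> U c q j ` {..<k * n}. f e) = sum f ?X + sum f ?Y + sum f (U c q j ` {..<k * n})"
    by (subst sum.union_disjoint; (subst sum.union_disjoint)?) auto
  also have "sum f (U c q j ` {..<k * n}) = (\<Sum>m<k * n. f (U c q j m))"
    by (subst sum.reindex) (auto simp: inj_on_def)
  also have "sum f ?X + sum f ?Y + \<dots> = ?R" by auto
  finally show ?thesis unfolding incident_V[OF assms] .
qed

lemma incident_D: "e \<in> Es \<Longrightarrow> D m \<in> ends e \<Longrightarrow> frac e (D m) = 0"
  by (cases e) auto

lemma incident_Z: "{e \<in> Es. Z s \<in> ends e} = {Zed}"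
proof (rule set_eqI)
  fix e show "e \<in> {e \<in> Es. Z s \<in> ends e} \<longleftrightarrow> e \<in> {Zed}"
    by (cases e; cases s) auto
qed

lemma load_frac_V:
  assumes "c < P" "q < n" "j \<le> n"
  shows "(\<Sum>e\<in>{e \<in> Es. V c q j \<in> ends e}. frac e (V c q j) * wt e (V c q j)) \<le> 1"
proof -
  have d: "0 \<le> b * \<delta>" "b * \<delta> \<le> \<delta>" using \<delta>_bounds by auto
  have *: "(\<Sum>m<k * n. frac (U c q j m) (V c q j) * wt (U c q j m) (V c q j)) = dust j"
    using k_pos n_pos by simp
  show ?thesis
  proof (cases j)
    case 0
    then show ?thesis
      unfolding sum_incident_V[OF assms] * using n_pos d \<delta>_bounds(1)
      by (simp add: dust_def algebra_simps)
  next
    case (Suc i)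
    have "(1 - b) * (1 - \<delta>) + \<delta> * (1 / 2) + b * (1 / 2 + \<delta>) + dust j \<le> 1"
      using Suc d \<delta>_bounds(1) unfolding dust_def by (simp add: algebra_simps)
    \<comment> \<open>The last vertex has no edge to its right, so its load lacks this nonnegative
      term.\<close>
    moreover have "0 \<le> b * (1 / 2 + \<delta>)" using \<delta>_bounds by simp
    ultimately show ?thesis
      unfolding sum_incident_V[OF assms] * using Suc by auto
  qed
qed

lemma star_frac_V:
  assumes "c < P" "q < n" "j \<le> n"
  shows "(\<Sum>e\<in>{e \<in> Es. V c q j \<in> ends e \<and> wt e (V c q j) > 1 / 2}. frac e (V c q j)) \<le> 1"
proof -
  have "{e \<in> Es. V c q j \<in> ends e \<and> wt e (V c q j) > 1 / 2}
      = {e \<in> {e \<in> Es. V c q j \<in> ends e}. wt e (V c q j) > 1 / 2}" by auto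
  moreover have "finite {e \<in> Es. V c q j \<in> ends e}" using finite_Es by simp
  ultimately have "(\<Sum>e\<in>{e \<in> Es. V c q j \<in> ends e \<and> wt e (V c q j) > 1 / 2}. frac e (V c q j))
     = (\<Sum>e\<in>{e \<in> Es. V c q j \<in> ends e}. if wt e (V c q j) > 1 / 2 then frac e (V c q j) else 0)"
    by (simp only: sum.inter_filter)
  also have "\<dots> \<le> 1"
    unfolding sum_incident_V[OF assms]
    using dust_weight(3)[of j] \<delta>_bounds by (cases j) (auto simp del: of_nat_mult)
  finally show ?thesis .
qed

text \<open>At most \<open>k\<close> pieces of dust weigh at most \<delta> together, and any other
  hyperedge at most \<open>1 - \<delta>\<close>. A set heavier than 1 therefore contains two members
  that are not dust, and their shares sum to at most 1.\<close>

lemma set_frac_V: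
  assumes "c < P" "q < n" "j \<le> n"
    and S: "S \<subseteq> {e \<in> Es. V c q j \<in> ends e}" "(\<Sum>e\<in>S. wt e (V c q j)) > 1" "card S \<le> k"
  shows "(\<Sum>e\<in>S. frac e (V c q j)) \<le> real (card S) - 1"
proof -
  define v where "v = V c q j"
  define A where "A = S - U c q j ` {..<k * n}"
  define B where "B = S \<inter> U c q j ` {..<k * n}"
  have fin: "finite S" using S(1) finite_Es by (metis (no_types, lifting) finite_subset mem_Collect_eq subsetI)
  have AB: "S = A \<union> B" "A \<inter> B = {}" "finite A" "finite B" using fin by (auto simp: A_def B_def)
  have card: "card S = card A + card B" using AB by (simp add: card_Un_disjoint)
  have split: "sum f S = sum f A + sum f B" for f :: "label \<Rightarrow> real"
    using AB by (simp add: sum.union_disjoint)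
  have sub: "A \<subseteq> (if j = 0 then {G c} else {H c q (j - 1), F c q}) \<union> (if j < n then {H c q j} else {})"
    using S(1) unfolding A_def incident_V[OF assms(1-3)] by auto
  have dust: "frac e v \<le> 1" "wt e v \<le> \<delta> / k" if "e \<in> B" for e
    using that dust_weight(2)[of j] by (auto simp: B_def v_def)
  have "(\<Sum>e\<in>B. wt e v) \<le> real (card B) * (\<delta> / k)"
    by (rule sum_bounded_above) (rule dust)
  also have "\<dots> \<le> real k * (\<delta> / k)"
    using S(3) card \<delta>_bounds(1) by (intro mult_right_mono) auto
  also have "\<dots> = \<delta>" using k_pos by simp
  finally have wB: "(\<Sum>e\<in>B. wt e v) \<le> \<delta>" .
  have elems: "e = G c \<and> j = 0 \<or> e = H c q (j - 1) \<and> j \<noteq> 0 \<or> e = F c q \<or> e = H c q j" if "e \<in> A" for e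
    using sub that by (auto split: if_splits)
  have wA: "wt e v \<le> 1 - \<delta>" if "e \<in> A" for e
    using elems[OF that] \<delta>_bounds(2) by (auto simp: v_def)
  have fA: "e = H c q j \<and> frac e v = b \<or> e = H c q (j - 1) \<and> frac e v = 1 - b \<or> frac e v = \<delta>"
    if "e \<in> A" for e
    using elems[OF that] by (cases j) (auto simp: v_def)
  have "card A \<ge> 2"
  proof (rule ccontr)
    assume "\<not> card A \<ge> 2"
    then have "card A = 0 \<or> card A = 1" by auto
    then have "(\<Sum>e\<in>A. wt e v) \<le> 1 - \<delta>"
      using AB(3) wA \<delta>_bounds(2) by (auto simp: card_1_singleton_iff)
    then show False using S(2) wB split[of "\<lambda>e. wt e v"] by (simp add: v_def)
  qed
  then have "(\<Sum>e\<in>A. frac e v) \<le> real (card A) - 1"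
  proof (rule sum_le_card_minus_1[OF AB(3)])
    fix e assume "e \<in> A"
    note e = fA[OF this]
    show "frac e v \<le> 1" using e \<delta>_bounds by linarith
    fix e' assume "e' \<in> A" and "e \<noteq> e'"
    \<comment> \<open>Either these are the two path edges, with shares \<open>b\<close> and
      \<open>1 - b\<close>, or one of the shares is \<delta>.\<close>
    then show "frac e v + frac e' v \<le> 1"
      using e fA[OF \<open>e' \<in> A\<close>] \<delta>_bounds by (elim disjE conjE; (linarith | simp))
  qed
  moreover have "(\<Sum>e\<in>B. frac e v) \<le> real (card B)"
    using sum_bounded_above[of B "\<lambda>e. frac e v" 1] dust by simp
  ultimately show ?thesis using split[of "\<lambda>e. frac e v"] card by (simp add: v_def)
qed

lemma feasible: "lp_feasible k 1 inst (lift frac)"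
proof (rule lp_feasible_inst)
  fix e v assume e: "e \<in> Es" "v \<in> ends e"
  show "0 \<le> frac e v" using \<delta>_bounds by (cases e) auto
  show "wt e v \<le> 1" by (rule wt_bounds)
next
  fix e assume "e \<in> Es"
  show "(\<Sum>v\<in>ends e. frac e v) = 1"
    by (cases e) (auto simp: card_image inj_on_def)
next
  fix v assume v: "v \<in> Vs"
  show "(\<Sum>e\<in>{e \<in> Es. v \<in> ends e}. frac e v * wt e v) \<le> 1"
    using v load_frac_V by (cases v) (auto simp: incident_D incident_Z)
  show "(\<Sum>e\<in>{e \<in> Es. v \<in> ends e \<and> wt e v > 1 / 2}. frac e v) \<le> 1"
  proof (cases v)
    case (Z s)
    have "{e \<in> Es. v \<in> ends e \<and> wt e v > 1 / 2} = {e \<in> {e \<in> Es. v \<in> ends e}. wt e v > 1 / 2}"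
      by auto
    also have "\<dots> = {Zed}" unfolding Z incident_Z by auto
    finally show ?thesis by simp
  qed (use v star_frac_V in \<open>auto simp: incident_D\<close>)
  fix S assume S: "S \<subseteq> {e \<in> Es. v \<in> ends e}" "(\<Sum>e\<in>S. wt e v) > 1" "card S \<le> k"
  show "(\<Sum>e\<in>S. frac e v) \<le> real (card S) - 1"
  proof (cases v)
    case (V c q j)
    then show ?thesis using v S set_frac_V by auto
  next
    case (D m)
    have "finite S" using S(1) finite_Es by (metis (no_types, lifting) finite_subset mem_Collect_eq subsetI)
    moreover have "S \<noteq> {}" using S(2) by auto
    ultimately have "card S \<ge> 1" by (simp add: Suc_leI card_gt_0_iff)
    moreover have "(\<Sum>e\<in>S. frac e v) = 0"
      using S(1) incident_D unfolding D by (intro sum.neutral) auto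
    ultimately show ?thesis by simp
  next
    case (Z s)
    then have "S \<subseteq> {Zed}" using S(1) incident_Z[of s] by simp
    then have "(\<Sum>e\<in>S. wt e v) \<le> 1" by (auto simp: subset_singleton_iff)
    then show ?thesis using S(2) by simp
  qed
qed

lemma lp_cost_frac: "lp_cost inst (lift frac) = 1 + b * (real P * n)"
proof -
  let ?h = "\<lambda>(c, q). H c q 0"
  let ?A = "?h ` ({..<P} \<times> {..<n})"
  let ?g = "\<lambda>e. \<Sum>v\<in>ends e. cst e v * frac e v"
  have "(\<Sum>e\<in>Es. ?g e) = (\<Sum>e\<in>insert Zed ?A. ?g e)"
  proof (rule sum.mono_neutral_right)
    show "insert Zed ?A \<subseteq> Es" using n_pos by auto
    show "\<forall>e\<in>Es - insert Zed ?A. ?g e = 0"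
    proof
      fix e assume e: "e \<in> Es - insert Zed ?A"
      show "?g e = 0"
      proof (cases e)
        case (H c q i)
        then have "i \<noteq> 0" using e by (auto simp: image_iff)
        then show ?thesis using H by simp
      qed (use e in auto)
    qed
  qed (rule finite_Es)
  also have "\<dots> = 1 + (\<Sum>e\<in>?A. ?g e)" by (subst sum.insert) auto
  also have "(\<Sum>e\<in>?A. ?g e) = (\<Sum>x\<in>{..<P} \<times> {..<n}. b)"
    by (subst sum.reindex) (simp_all add: inj_on_def split_def)
  finally show ?thesis unfolding lp_cost_inst by simp
qed

text \<open>Every fractional solution pays 1 for \<open>Zed\<close>, which costs 1 at both ends.
  This keeps the optimal value positive.\<close>

lemma lp_cost_ge_1:
  assumes "lp_feasible k T (scale_weights T inst) x"
  shows "lp_cost (scale_weights T inst) x \<ge> 1"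
proof -
  let ?h = "hyperedge Zed"
  have x: "0 \<le> x h u" if "h \<in> hedges inst" "u \<in> h" for h u
    using assms that by (auto simp: lp_feasible_def scale_weights_def)
  have c: "0 \<le> cost inst h u" if "h \<in> hedges inst" "u \<in> h" for h u
    using unrelated that by (auto simp: unrelated_gb_instance_def)
  have "1 = (\<Sum>u\<in>?h. x ?h u)" using assms by (auto simp: lp_feasible_def scale_weights_def)
  also have "\<dots> = (\<Sum>u\<in>?h. cost inst ?h u * x ?h u)"
    by (simp add: sum_hyperedge)
  also have "\<dots> \<le> (\<Sum>h\<in>hedges inst. \<Sum>u\<in>h. cost inst h u * x h u)"
    using finite_Es x c
    by (intro member_le_sum[of ?h "hedges inst" "\<lambda>h. \<Sum>u\<in>h. cost inst h u * x h u"])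
      (auto intro!: sum_nonneg)
  finally show ?thesis by (simp add: lp_cost_def scale_weights_def)
qed

section \<open>Orientations of bounded makespan\<close>

context
  fixes \<eta> :: "nat set \<Rightarrow> nat" and t :: real
  assumes orient: "orientation inst \<eta>" and span: "makespan inst \<eta> \<le> t"
    and t_le: "t \<le> 2" and t_less: "t < 3 / 2 + b / 2 - 4 * \<delta>"
begin

abbreviation "to \<equiv> label_orientation \<eta>"

definition lost :: "nat \<Rightarrow> nat \<Rightarrow> nat \<Rightarrow> nat set" where
  "lost c q j = {m. m < k * n \<and> to (U c q j m) = D m}"

text \<open>The threshold \<open>k\<close> is the fraction \<open>1 / n\<close> of the
  \<open>k * n\<close> pieces at a vertex, so every path vertex outside \<open>bad\<close> keeps its
  dust up to a fraction \<delta>.\<close>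

definition bad :: "(nat \<times> nat \<times> nat) set" where
  "bad = {(c, q, j). c < P \<and> q < n \<and> j \<le> n \<and> k < card (lost c q j)}"

lemma finite_bad: "finite bad"
  by (rule finite_subset[of _ "{..<P} \<times> {..<n} \<times> {..n}"]) (auto simp: bad_def)

text \<open>Dust has weight \<open>1 / 2\<close> at \<open>D m\<close>, so \<open>D m\<close> absorbs at most four of the hyperedges
  \<open>U c q j m\<close>, however many copies there are.\<close>

lemma card_lost_to_D:
  assumes "m < k * n"
  shows "card {(c, q, j) \<in> bad. to (U c q j m) = D m} \<le> 4"
proof -
  let ?A = "{(c, q, j) \<in> bad. to (U c q j m) = D m}"
  let ?u = "\<lambda>(c, q, j). U c q j m"
  have "real (card ?A) * (1 / 2) = (\<Sum>e\<in>?u ` ?A. wt e (D m))"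
    by (subst sum.reindex) (auto simp: inj_on_def split_def)
  also have "\<dots> \<le> (\<Sum>e\<in>{e \<in> Es. to e = D m}. wt e (D m))"
    using finite_Es wt_bounds assms by (intro sum_mono2) (auto simp: bad_def)
  also have "\<dots> \<le> 2"
    using load_le_makespan[OF orient, of "D m"] assms span t_le by auto
  finally show ?thesis by simp
qed

text \<open>Double counting of lost pieces: each bad vertex loses more than \<open>k\<close>, while
  each of the \<open>k * n\<close> shared vertices takes at most four. The bound does not depend on
  \<open>P\<close>, so most copies are unaffected once \<open>P\<close> is large.\<close>

lemma card_bad: "card bad \<le> 4 * n"
proof -
  have "card bad * k \<le> (\<Sum>(c, q, j)\<in>bad. card (lost c q j))"
    using sum_bounded_below[of bad k "\<lambda>(c, q, j). card (lost c q j)"] by (auto simp: bad_def)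
  also have "\<dots> = (\<Sum>(c, q, j)\<in>bad. \<Sum>m<k * n. if to (U c q j m) = D m then 1 else 0)"
  proof (rule sum.cong[OF refl], clarify)
    fix c q j
    have "lost c q j = {m \<in> {..<k * n}. to (U c q j m) = D m}" by (auto simp: lost_def)
    then show "card (lost c q j) = (\<Sum>m<k * n. if to (U c q j m) = D m then 1 else 0)"
      by (simp add: sum.inter_filter[symmetric])
  qed
  also have "\<dots> = (\<Sum>m<k * n. \<Sum>(c, q, j)\<in>bad. if to (U c q j m) = D m then 1 else 0)"
    unfolding split_def by (rule sum.swap)
  also have "\<dots> \<le> (\<Sum>m<k * n. 4)"
  proof (rule sum_mono)
    fix m assume "m \<in> {..<k * n}"
    then have "card {x \<in> bad. to (U (fst x) (fst (snd x)) (snd (snd x)) m) = D m} \<le> 4"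
      using card_lost_to_D[of m] by (simp add: split_def)
    then show "(\<Sum>(c, q, j)\<in>bad. if to (U c q j m) = D m then 1 else 0) \<le> (4::nat)"
      unfolding split_def by (simp add: sum.inter_filter[OF finite_bad, symmetric])
  qed
  also have "\<dots> = (4 * n) * k" by simp
  finally show ?thesis using k_pos by simp
qed

text \<open>At least \<open>k * n - k\<close> pieces stay at a good vertex, of total weight at least
  \<open>dust j * (1 - \<delta>)\<close>. They add to whatever else, collected in \<open>A\<close>,
  is assigned there.\<close>

lemma load_good:
  assumes v: "c < P" "q < n" "j \<le> n" "(c, q, j) \<notin> bad"
    and A: "A \<subseteq> Es" "\<And>m. U c q j m \<notin> A" "\<And>e. e \<in> A \<Longrightarrow> to e = V c q j"
  shows "(\<Sum>e\<in>A. wt e (V c q j)) + dust j - \<delta> \<le> t"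
proof -
  let ?v = "V c q j"
  define B where "B = U c q j ` ({..<k * n} - lost c q j)"
  have lost: "lost c q j \<subseteq> {..<k * n}" "card (lost c q j) \<le> k" "finite (lost c q j)"
    using v by (auto simp: lost_def bad_def)
  have "dust j - \<delta> \<le> dust j - dust j * \<delta>"
    using dust_bounds[of j] \<delta>_bounds(1) by simp
  also have "\<dots> = real (k * n - k) * (dust j / (k * n))"
    using k_pos n_pos by (simp add: of_nat_diff \<delta>_def field_simps)
  also have "\<dots> \<le> real (card ({..<k * n} - lost c q j)) * (dust j / (k * n))"
    using lost dust_weight(1) by (intro mult_right_mono) (auto simp: card_Diff_subset)
  also have "\<dots> = (\<Sum>e\<in>B. wt e ?v)"
    unfolding B_def by (subst sum.reindex) (auto simp: inj_on_def)
  finally have B: "dust j - \<delta> \<le> (\<Sum>e\<in>B. wt e ?v)" .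
  have toB: "to e = ?v" "e \<in> Es" if "e \<in> B" for e
  proof -
    obtain m where m: "e = U c q j m" "m < k * n" "m \<notin> lost c q j" using \<open>e \<in> B\<close> by (auto simp: B_def)
    then show "e \<in> Es" using v by simp
    then have "to e \<in> ends e" using code_label_orientation(2)[OF orient] by simp
    then show "to e = ?v" using m by (auto simp: lost_def)
  qed
  have "finite A" "finite B" "A \<inter> B = {}"
    using A finite_Es finite_subset by (auto simp: B_def)
  then have "(\<Sum>e\<in>A. wt e ?v) + (\<Sum>e\<in>B. wt e ?v) = (\<Sum>e\<in>A \<union> B. wt e ?v)"
    by (simp add: sum.union_disjoint)
  also have "\<dots> \<le> (\<Sum>e\<in>{e \<in> Es. to e = ?v}. wt e ?v)"
    using finite_Es A toB wt_bounds by (intro sum_mono2) auto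
  also have "\<dots> \<le> t"
    using load_le_makespan[OF orient, of ?v] v span by auto
  finally show ?thesis using B by simp
qed

text \<open>Wherever \<open>F c q\<close> lands, it pushes the edge before that vertex to the left;
  each edge so displaced pushes its predecessor, down to the first one.\<close>

lemma good_path:
  assumes cq: "c < P" "q < n" and good: "\<And>j. j \<le> n \<Longrightarrow> (c, q, j) \<notin> bad"
  shows "to (H c q 0) = V c q 0"
proof -
  \<comment> \<open>A hyperedge of weight at least \<open>1 / 2\<close> at
    \<open>V c q (Suc j)\<close> bars \<open>H c q j\<close> from it: with the dust, the load would
    be at least \<open>3 / 2 + b / 2 - 4 * \<delta>\<close>, which exceeds \<open>t\<close>.\<close>
  have left: "to (H c q j) = V c q j"
    if "j < n" "e \<in> Es" "e \<noteq> H c q j" "to e = V c q (Suc j)" "\<And>i m. e \<noteq> U c q i m"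
      "wt e (V c q (Suc j)) \<ge> 1 / 2" for e j
  proof (rule ccontr)
    assume *: "to (H c q j) \<noteq> V c q j"
    have "to (H c q j) \<in> ends (H c q j)"
      using code_label_orientation(2)[OF orient, of "H c q j"] cq that(1) by simp
    then have H: "to (H c q j) = V c q (Suc j)" using * by auto
    have "(\<Sum>e\<in>{H c q j, e}. wt e (V c q (Suc j))) + dust (Suc j) - \<delta> \<le> t"
      using cq that good[of "Suc j"] H by (intro load_good) auto
    then have "(1 - \<delta>) + 1 / 2 + dust (Suc j) - \<delta> \<le> t"
      using that(3,6) by simp
    then show False using t_less by (simp add: dust_def)
  qed
  have "to (F c q) \<in> ends (F c q)"
    using code_label_orientation(2)[OF orient, of "F c q"] cq by simp
  then obtain j where j: "j < n" "to (F c q) = V c q (Suc j)"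
    by (auto simp: less_eq_Suc_le) (metis Suc_le_D Suc_le_mono)
  have start: "to (H c q j) = V c q j"
    by (rule left[of j "F c q"]) (use j cq in auto)
  \<comment> \<open>\<open>i\<close> is the distance walked back from edge \<open>j\<close>; at each
    step the edge just shown to point left takes the place of \<open>e\<close> in
    \<open>left\<close>.\<close>
  have "to (H c q (j - i)) = V c q (j - i)" if "i \<le> j" for i
    using that
  proof (induction i)
    case (Suc i)
    then have "j - i = Suc (j - Suc i)" by simp
    then show ?case
      using Suc j cq \<delta>_bounds(1,2) by (intro left[of _ "H c q (j - i)"]) auto
  qed (use start in simp)
  from this[of j] show ?thesis by simp
qed

text \<open>A bad vertex spoils only its own path, so at least \<open>P * n - 4 * n\<close> first
  edges sit at the end where they cost 1; \<open>Zed\<close> adds 1.\<close>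

lemma gap_cost: "orientation_cost inst \<eta> \<ge> 1 + real P * n - 4 * n"
proof -
  define X where "X = (\<lambda>(c, q, j). (c, q)) ` bad"
  define Y where "Y = {..<P} \<times> {..<n} - X"
  let ?h = "\<lambda>(c, q). H c q 0"
  have X: "finite X" "card X \<le> 4 * n"
    using finite_bad card_bad card_image_le[OF finite_bad] by (auto simp: X_def intro: order_trans)
  have good: "to (?h x) = V (fst x) (snd x) 0" "?h x \<in> Es" if "x \<in> Y" for x
  proof -
    obtain c q where x: "x = (c, q)" "c < P" "q < n" "(c, q) \<notin> X" using \<open>x \<in> Y\<close> by (auto simp: Y_def)
    then have "(c, q, j) \<notin> bad" for j by (force simp: X_def)
    then show "to (?h x) = V (fst x) (snd x) 0" "?h x \<in> Es" using x good_path n_pos by auto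
  qed
  have "real P * n - 4 * n \<le> real (card Y)"
  proof -
    have "P * n \<le> card Y + card X"
      using diff_card_le_card_Diff[OF X(1), of "{..<P} \<times> {..<n}"] by (simp add: Y_def)
    then have "P * n \<le> card Y + 4 * n" using X(2) by simp
    then have "real (P * n) \<le> real (card Y + 4 * n)" by (simp only: of_nat_le_iff)
    then show ?thesis by simp
  qed
  also have "\<dots> = (\<Sum>e\<in>?h ` Y. cst e (to e))"
    using good(1) by (subst sum.reindex) (auto simp: inj_on_def split_def)
  finally have "1 + real P * n - 4 * n \<le> (\<Sum>e\<in>insert Zed (?h ` Y). cst e (to e))"
    by (subst sum.insert) (auto simp: Y_def)
  also have "\<dots> \<le> (\<Sum>e\<in>Es. cst e (to e))"
    using good(2) finite_Es cst_nonneg by (intro sum_mono2) auto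
  finally show ?thesis unfolding orientation_cost_inst[OF orient] .
qed

text \<open>With more than \<open>4 * n\<close> copies, one has no bad vertex. There every first
  edge is assigned to the first vertex of its path, and \<open>G c\<close> joins one of them, giving
  load at least \<open>(1 - \<delta>) + 1 / 2 + dust 0 - \<delta> = 5 / 2 - b - 4 *
  \<delta>\<close>.\<close>

lemma copies_le:
  assumes "t < 5 / 2 - b - 4 * \<delta>"
  shows "P \<le> 4 * n"
proof (rule ccontr)
  assume "\<not> P \<le> 4 * n"
  moreover have "card (fst ` bad) \<le> 4 * n"
    using card_bad card_image_le[OF finite_bad] by (rule order_trans[rotated])
  ultimately have "card (fst ` bad) < card {..<P}" by simp
  then obtain c where "c < P" "c \<notin> fst ` bad"
    using card_mono[of "fst ` bad" "{..<P}"] finite_bad by (meson finite_imageI lessThan_iff not_le subsetI)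
  then have good: "(c, q, j) \<notin> bad" for q j by force
  have "to (G c) \<in> ends (G c)"
    using code_label_orientation(2)[OF orient, of "G c"] \<open>c < P\<close> by simp
  then obtain q where q: "q < n" "to (G c) = V c q 0" by auto
  have "(\<Sum>e\<in>{H c q 0, G c}. wt e (V c q 0)) + dust 0 - \<delta> \<le> t"
    using \<open>c < P\<close> q good n_pos good_path[OF \<open>c < P\<close> q(1)] by (intro load_good) auto
  then show False using assms by (simp add: dust_def)
qed

end

section \<open>Scaled instances and the choice of parameters\<close>

lemma orientation_cost_ge_1:
  assumes "orientation inst \<eta>"
  shows "orientation_cost inst \<eta> \<ge> 1"
  unfolding orientation_cost_inst[OF assms]
  using member_le_sum[of Zed Es "\<lambda>e. cst e (label_orientation \<eta> e)"] finite_Es cst_nonneg by simp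

text \<open>The optimal value is at most the cost of \<open>frac\<close>, so a comparison with the
  latter suffices. Taking \<open>max 0 \<rho>\<close> covers a negative factor, which occurs for
  \<open>\<epsilon> > 1\<close> and would reverse the inequality.\<close>

lemma cost_gap_scaled:
  assumes "T > 0"
    and cost_lower: "\<And>\<eta>. orientation inst \<eta> \<Longrightarrow> makespan inst \<eta> \<le> \<alpha> \<Longrightarrow>
      max 0 \<rho> * (1 + b * (real P * n)) \<le> orientation_cost inst \<eta>"
  shows "OPT_LP k T (scale_weights T inst) > 0" "cost_gap k T \<alpha> \<rho> (scale_weights T inst)"
proof -
  let ?J = "scale_weights T inst"
  let ?C = "{lp_cost ?J x |x. lp_feasible k T ?J x}"
  have cost: "lp_cost ?J = lp_cost inst" "orientation_cost ?J = orientation_cost inst"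
    "orientation ?J = orientation inst"
    by (auto simp: lp_cost_def orientation_cost_def orientation_def scale_weights_def fun_eq_iff)
  have feas: "lp_feasible k T ?J (lift frac)"
    using lp_feasible_scale_weights[OF feasible assms(1)] .
  have ge: "\<And>a. a \<in> ?C \<Longrightarrow> 1 \<le> a" using lp_cost_ge_1 by auto
  then have "1 \<le> OPT_LP k T ?J"
    unfolding OPT_LP_def using feas by (intro cInf_greatest) auto
  then show "OPT_LP k T ?J > 0" by simp
  have "OPT_LP k T ?J \<le> lp_cost ?J (lift frac)"
    unfolding OPT_LP_def using feas ge by (intro cInf_lower) (auto simp: bdd_below_def)
  then have "max 0 \<rho> * OPT_LP k T ?J \<le> max 0 \<rho> * (1 + b * (real P * n))"
    by (intro mult_left_mono) (auto simp: cost lp_cost_frac)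
  moreover have "\<rho> * OPT_LP k T ?J \<le> max 0 \<rho> * OPT_LP k T ?J"
    using \<open>1 \<le> OPT_LP k T ?J\<close> by (intro mult_right_mono) auto
  ultimately have opt: "\<rho> * OPT_LP k T ?J \<le> max 0 \<rho> * (1 + b * (real P * n))" by linarith
  show "cost_gap k T \<alpha> \<rho> ?J"
    unfolding cost_gap_def
  proof (intro conjI allI impI)
    show "\<exists>x. lp_feasible k T ?J x" using feas by auto
    fix \<eta> assume \<eta>: "orientation ?J \<eta> \<and> makespan ?J \<eta> \<le> \<alpha> * T"
    have "verts inst \<noteq> {}" using mem_Vs(3) by (auto simp del: mem_Vs)
    then have "T * makespan inst \<eta> \<le> \<alpha> * T"
      using \<eta> makespan_scale_weights[of inst T \<eta>] finite_Vs assms(1) by simp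
    then have "makespan inst \<eta> \<le> \<alpha>" using assms(1) by (simp add: mult.commute)
    then show "\<rho> * OPT_LP k T ?J \<le> orientation_cost ?J \<eta>"
      using cost_lower[of \<eta>] opt \<eta> cost by auto
  qed
qed

end

text \<open>With all costs set to 0, the optimal value and every orientation cost vanish, so the
  cost gap reads \<open>0 \<ge> 0\<close>. This settles the claim with unscaled weights for
  \<open>T \<ge> 1\<close>.\<close>

lemma zero_cost_instance:
  fixes I :: "nat gb"
  assumes I: "unrelated_gb_instance \<beta> I" and x: "lp_feasible k 1 I x" and "T \<ge> 1"
  shows "\<exists>I'::nat gb. unrelated_gb_instance \<beta> I' \<and> cost_gap k T \<alpha> \<rho> I'"
proof (intro exI conjI)
  let ?I = "I\<lparr>cost := \<lambda>_ _. 0\<rparr>"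
  have "makespan ?I = makespan I" "orientation ?I = orientation I"
    by (auto simp: makespan_def load_def orientation_def fun_eq_iff)
  then have "opt_makespan ?I = opt_makespan I" by (simp add: opt_makespan_def)
  moreover have "light \<beta> ?I = light \<beta> I" "heavy \<beta> ?I = heavy \<beta> I"
    by (auto simp: light_def heavy_def fun_eq_iff)
  ultimately show "unrelated_gb_instance \<beta> ?I"
    using I by (simp add: unrelated_gb_instance_def)
  have "incident ?I = incident I" by (auto simp: incident_def)
  then have feas: "lp_feasible k T ?I x"
    using lp_feasible_mono[OF finite_hedges[OF I] x \<open>T \<ge> 1\<close>] by (simp add: lp_feasible_def)
  have "{lp_cost ?I x |x. lp_feasible k T ?I x} = {0}"
    using feas by (auto simp: lp_cost_def)
  then have "OPT_LP k T ?I = 0" by (simp add: OPT_LP_def)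
  then show "cost_gap k T \<alpha> \<rho> ?I"
    using feas by (auto simp: cost_gap_def orientation_cost_def)
qed

lemma makespan_gap:
  fixes k :: nat and \<epsilon> :: real
  assumes "k > 0" "\<epsilon> > 0"
  shows "\<exists>I::nat gb. unrelated_gb_instance (1/2) I \<and> (\<exists>x. lp_feasible k 1 I x) \<and>
    (\<forall>\<eta>. orientation I \<eta> \<longrightarrow> makespan I \<eta> \<ge> 11/6 - \<epsilon>)"
proof -
  define e where "e = min \<epsilon> (1 / 3)"
  have e: "e > 0" "e \<le> 1 / 3" "e \<le> \<epsilon>" using assms by (auto simp: e_def)
  obtain n :: nat where n: "n > 0" "1 / real n < e / 4"
    using real_arch_inverse[of "e / 4"] e(1) by (auto simp: inverse_eq_divide)
  have "4 / real n < e" using n by simp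
  then have "4 / real n \<le> 2 / 3" "4 / real n \<le> 1 - 2 / 3" using e(2) by linarith+
  \<comment> \<open>\<open>b = 2 / 3\<close> balances the two overload bounds:
    \<open>3 / 2 + b / 2\<close> and \<open>5 / 2 - b\<close> both equal \<open>11 / 6\<close>. One
    copy more than \<open>4 * n\<close> contradicts \<open>copies_le\<close>.\<close>
  then interpret gap_instance k n "4 * n + 1" "2 / 3"
    using assms n by unfold_locales
  have "4 * \<delta> < e" using n by (simp add: \<delta>_def)
  have "makespan inst \<eta> \<ge> 11/6 - \<epsilon>" if "orientation inst \<eta>" for \<eta>
  proof (rule ccontr)
    assume "\<not> makespan inst \<eta> \<ge> 11/6 - \<epsilon>"
    then have "makespan inst \<eta> \<le> 11/6 - e" using e by linarith
    then have "4 * n + 1 \<le> 4 * n"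
      by (rule copies_le[OF that]) (use \<open>4 * \<delta> < e\<close> e in auto)
    then show False by simp
  qed
  then show ?thesis using unrelated feasible by blast
qed

lemma scaled_cost_gap:
  fixes k :: nat and \<gamma> T \<epsilon> :: real
  assumes "k > 0" "1/12 \<le> \<gamma>" "\<gamma> \<le> 1/4" "\<epsilon> > 0" "T > 0"
  shows "\<exists>I::nat gb. unrelated_gb_instance (1/2) I \<and> OPT_LP k T (scale_weights T I) > 0 \<and>
    cost_gap k T (7/4 + \<gamma>) ((1 - \<epsilon>) / (2 * \<gamma> + 1/2)) (scale_weights T I)"
proof -
  \<comment> \<open>At \<open>b = b0\<close> the bound \<open>3 / 2 + b / 2\<close> equals
    \<open>7 / 4 + \<gamma>\<close>; any larger \<open>b\<close> forces the first edges once
    \<delta> is small.\<close>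
  define b0 where "b0 = 2 * \<gamma> + 1/2"
  have b0: "2/3 \<le> b0" "b0 \<le> 1" "7/4 + \<gamma> = 3/2 + b0/2" using assms by (auto simp: b0_def field_simps)
  show ?thesis
  proof (cases "1 - \<epsilon> \<le> b0")
    case True
    \<comment> \<open>The ratio sought is at most 1, so \<open>Zed\<close> alone suffices, without
      copies; \<open>n = 8\<close> and \<open>b = 1 / 2\<close> meet the locale bounds with
      equality.\<close>
    interpret gap_instance k 8 0 "1/2" using assms by unfold_locales auto
    let ?\<rho> = "(1 - \<epsilon>) / (2 * \<gamma> + 1/2)"
    have "max 0 ?\<rho> \<le> 1" using True assms(2) by (simp add: b0_def divide_simps)
    then have "max 0 ?\<rho> * (1 + 1/2 * (real 0 * real 8)) \<le> orientation_cost inst \<eta>"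
      if "orientation inst \<eta>" for \<eta>
      using orientation_cost_ge_1[OF that] by simp
    then have "OPT_LP k T (scale_weights T inst) > 0"
      "cost_gap k T (7/4 + \<gamma>) ?\<rho> (scale_weights T inst)"
      using cost_gap_scaled[of T "7/4 + \<gamma>" ?\<rho>] assms(5) by auto
    then show ?thesis using unrelated by blast
  next
    case False
    \<comment> \<open>The midpoint of \<open>b0\<close> and \<open>b0 / (1 - \<epsilon>)\<close>
      gives \<open>\<rho> * b = 1 - \<epsilon> / 2\<close>.\<close>
    define b where "b = (b0 + b0 / (1 - \<epsilon>)) / 2"
    define \<rho> where "\<rho> = (1 - \<epsilon>) / b0"
    have "b0 < b0 / (1 - \<epsilon>)" "b0 / (1 - \<epsilon>) < 1"
      using False b0 assms(4) by (simp_all add: field_simps)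
    then have b: "b0 < b" "b < 1" using b0(2) by (simp_all add: b_def)
    have \<rho>: "\<rho> * b = 1 - \<epsilon> / 2" "0 \<le> \<rho>"
      using False b0(1) by (auto simp: b_def \<rho>_def field_simps)
    obtain n :: nat where n: "n > 0" "1 / real n < min ((b - b0) / 8) ((1 - b) / 4)"
      using real_arch_inverse[of "min ((b - b0) / 8) ((1 - b) / 4)"] b
      by (auto simp: inverse_eq_divide)
    \<comment> \<open>The slack \<open>\<epsilon> / 2\<close> per path must pay for the
      \<open>4 * n\<close> spoiled paths and for the \<open>\<rho>\<close> due to
      \<open>Zed\<close>.\<close>
    obtain P :: nat where P: "2 * (4 + \<rho>) / \<epsilon> \<le> real P" using real_arch_simple by blast
    interpret gap_instance k n P b
      using assms(1) n b b0 by unfold_locales auto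
    have "4 * \<delta> < b / 2 - b0 / 2" using n by (simp add: \<delta>_def)
    moreover have "\<rho> * (1 + b * (real P * n)) \<le> 1 + real P * n - 4 * n"
    proof -
      have "(4 + \<rho>) * 1 \<le> \<epsilon> / 2 * real P" using P assms(4) by (simp add: field_simps)
      then have "(4 + \<rho>) * n \<le> \<epsilon> / 2 * real P * n" by (intro mult_right_mono) auto
      moreover have "\<rho> \<le> \<rho> * n" using n \<rho>(2) by (simp add: mult_le_cancel_left1)
      moreover have "\<rho> * (1 + b * (real P * n)) = \<rho> + (\<rho> * b) * (real P * n)"
        by (simp add: algebra_simps)
      ultimately show ?thesis unfolding \<rho>(1) by (simp add: algebra_simps)
    qed
    ultimately have "max 0 \<rho> * (1 + b * (real P * n)) \<le> orientation_cost inst \<eta>"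
      if "orientation inst \<eta>" "makespan inst \<eta> \<le> 7/4 + \<gamma>" for \<eta>
      using gap_cost[OF that] assms(3) b0(3) \<rho>(2) by simp
    then have "OPT_LP k T (scale_weights T inst) > 0"
      "cost_gap k T (7/4 + \<gamma>) \<rho> (scale_weights T inst)"
      using cost_gap_scaled[of T "7/4 + \<gamma>" \<rho>] assms(5) by auto
    then show ?thesis using unrelated unfolding \<rho>_def b0_def by blast
  qed
qed

theorem theorem6:
  fixes k :: nat
  assumes "k > 0"
  shows "(\<forall>\<epsilon>::real. \<epsilon> > 0 \<longrightarrow>
            (\<exists>I::nat gb. unrelated_gb_instance (1/2) I \<and>
               (\<exists>x. lp_feasible k 1 I x) \<and>
               (\<forall>\<eta>. orientation I \<eta> \<longrightarrow> makespan I \<eta> \<ge> 11/6 - \<epsilon>))) \<and>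
         (\<forall>\<gamma> T \<epsilon>::real. 1/12 \<le> \<gamma> \<and> \<gamma> \<le> 1/4 \<and> \<epsilon> > 0 \<longrightarrow>
            (T \<ge> 1 \<longrightarrow>
               (\<exists>I::nat gb. unrelated_gb_instance (1/2) I \<and>
                  cost_gap k T (7/4 + \<gamma>) ((1 - \<epsilon>) / (2 * \<gamma> + 1/2)) I)) \<and>
            (T > 0 \<longrightarrow>
               (\<exists>I::nat gb. unrelated_gb_instance (1/2) I \<and>
                  OPT_LP k T (scale_weights T I) > 0 \<and>
                  cost_gap k T (7/4 + \<gamma>) ((1 - \<epsilon>) / (2 * \<gamma> + 1/2)) (scale_weights T I))))"
proof (intro conjI allI impI)
  show "\<exists>I::nat gb. unrelated_gb_instance (1/2) I \<and> (\<exists>x. lp_feasible k 1 I x) \<and>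
    (\<forall>\<eta>. orientation I \<eta> \<longrightarrow> makespan I \<eta> \<ge> 11/6 - \<epsilon>)" if "\<epsilon> > 0" for \<epsilon> :: real
    using makespan_gap[OF assms that] .
  show "\<exists>I::nat gb. unrelated_gb_instance (1/2) I \<and>
    cost_gap k T (7/4 + \<gamma>) ((1 - \<epsilon>) / (2 * \<gamma> + 1/2)) I" if "T \<ge> 1" for \<gamma> T \<epsilon> :: real
    \<comment> \<open>Here \<open>makespan_gap\<close> merely supplies an instance that is feasible
      for target 1.\<close>
    using makespan_gap[OF assms zero_less_one] zero_cost_instance[OF _ _ that] by blast
  show "\<exists>I::nat gb. unrelated_gb_instance (1/2) I \<and> OPT_LP k T (scale_weights T I) > 0 \<and>
    cost_gap k T (7/4 + \<gamma>) ((1 - \<epsilon>) / (2 * \<gamma> + 1/2)) (scale_weights T I)"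
    if "1/12 \<le> \<gamma> \<and> \<gamma> \<le> 1/4 \<and> \<epsilon> > 0" "T > 0" for \<gamma> T \<epsilon> :: real
    using scaled_cost_gap[OF assms] that by blast
qed

end
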